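(* Let $F:U\to Y$ be completely continuous, i.e., $u_n\rightharpoonup u$ weakly in $U$ implies $F(u_n)\to F(u)$ strongly in $Y$. Assume that there are constants $L>0$, $\rho_0>0$ with $\|G_u\|_{\mathbb{L}(U,Y)}\le L$ for all $u\in\overline B_U(u^\dag,\rho_0)$; that there are constants $\rho\in(0,\rho_0]$ and $\mu\in[0,1)$ with $$\|F(\hat u)-F(u)-G_u(\hat u-u)\|_Y\le\mu\|F(\hat u)-F(u)\|_Y\quad\text{for all }u,\hat u\in\overline B_U(u^\dag,\rho);$$ and that there are a Banach space $Z\subset U$, compactly embedded in $U$, with $\bigcup_{u\in U}\mathcal R(G_u^* )\subset Z$, and a constant $\hat L>0$ with $\|G_u^*\|_{\mathbb{L}(Y,Z)}\le\hat L$ for all $u\in\overline B_U(u^\dag,\rho)$. Let $\tau>1$ and $\Lambda\ge\lambda>0$ satisfy $$\frac{2(\mu+1)}{\tau}-(2-2\mu-\Lambda L^2)<0\qquad\text{and}\qquad -1+\mu+5\Lambda L^2<0.$$ Let $\{\delta_k\}_{k\in\mathbb N}$ be a sequence of positive numbers converging to $0$, with noisy data $y^{\delta_k}\in Y$, $\|y^{\delta_k}-y^\dag\|_Y\le\delta_k$. Let the starting point $u_0\in\overline B_U(u^\dag,\rho)$ and the step sizes $w_n\in[\lambda,\Lambda]$ be arbitrary, and let the stopping index $N_k:=N(\delta_k,y^{\delta_k})$ be chosen according to the discrepancy principle. Then any subsequence of $\{u^{\delta_k}_{N_k}\}_{k\in\mathbb N}$ generated by the modified Landweber iteration contains a subsequence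 that converges strongly in $U$ to an element of $S(u^\dag,\rho)$. Furthermore, if $u^\dag$ is the unique solution of $F(u)=y^\dag$, then $u^{\delta_k}_{N_k}\to u^\dag$ in $U$ as $k\to\infty$.
   Context: $U,Y$ are real Hilbert spaces, $F:U\to Y$ is a mapping, $u^\dag\in U$ and $y^\dag=F(u^\dag)$. $\overline B_U(u,\rho)$ is the closed ball in $U$ of radius $\rho$ centered at $u$, and $S(u^\dag,\rho):=\{u\in\overline B_U(u^\dag,\rho):F(u)=y^\dag\}$. $\mathbb{L}(X,Y)$ is the space of bounded linear operators. $u\mapsto G_u\in\mathbb{L}(U,Y)$ is a given mapping on $U$ (not assumed continuous), $G_u^*\in\mathbb{L}(Y,U)$ is the Hilbert space adjoint of $G_u$, and $\mathcal R(\cdot)$ denotes the range. Modified Landweber iteration: for $\delta>0$ and $y^\delta\in Y$ with $\|y^\delta-y^\dag\|_Y\le\delta$, set $u_0^\delta:=u_0$ and $u_{n+1}^\delta=u_n^\delta+w_nG_{u_n^\delta}^*(y^\delta-F(u_n^\delta))$, $n\ge0$, with step sizes $w_n>0$ (independent of $\delta$). Discrepancy principle: for a constant $\tau>1$, the stopping index $N_\delta=N(\delta,y^\delta)$ is defined by $\|y^\delta-F(u^\delta_{N_\delta})\|_Y\le\tau\delta<\|y^\delta-F(u_n^\delta)\|_Y$ for $0\le n<N_\delta$. *)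

theory Defs
  imports "HOL-Analysis.Analysis"
begin

definition weakly_converges :: "(nat \<Rightarrow> 'a::real_normed_vector) \<Rightarrow> 'a \<Rightarrow> bool" where
  "weakly_converges x l \<longleftrightarrow>
     (\<forall>\<phi>::'a \<Rightarrow> real. bounded_linear \<phi> \<longrightarrow> (\<lambda>n. \<phi> (x n)) \<longlonglongrightarrow> \<phi> l)"

definition completely_continuous ::
  "('a::real_normed_vector \<Rightarrow> 'b::real_normed_vector) \<Rightarrow> bool" where
  "completely_continuous F \<longleftrightarrow>
     (\<forall>x l. weakly_converges x l \<longrightarrow> (\<lambda>n. F (x n)) \<longlonglongrightarrow> F l)"

text \<open>An inclusion of a Banach space \<open>Z\<close> (with its own, stronger norm) into \<open>U\<close> is encoded by a
  type for \<open>Z\<close> together with the inclusion map \<open>j\<close>, so that the subset of \<open>U\<close> is \<open>range j\<close>.\<close>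

definition compact_embedding ::
  "('z::real_normed_vector \<Rightarrow> 'u::real_normed_vector) \<Rightarrow> bool" where
  "compact_embedding j \<longleftrightarrow>
     bounded_linear j \<and> inj j \<and> (\<forall>B. bounded B \<longrightarrow> compact (closure (j ` B)))"

definition solution_set ::
  "('u::metric_space \<Rightarrow> 'y) \<Rightarrow> 'u \<Rightarrow> real \<Rightarrow> 'u set" where
  "solution_set F u\<^sub>d \<rho> = {u \<in> cball u\<^sub>d \<rho>. F u = F u\<^sub>d}"

primrec landweber ::
  "('u::real_inner \<Rightarrow> 'y::real_inner) \<Rightarrow> ('u \<Rightarrow> 'u \<Rightarrow>\<^sub>L 'y) \<Rightarrow> (nat \<Rightarrow> real) \<Rightarrow> 'u \<Rightarrow> 'y \<Rightarrow> nat \<Rightarrow> 'u" where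
  "landweber F G w u\<^sub>0 yd 0 = u\<^sub>0"
| "landweber F G w u\<^sub>0 yd (Suc n) =
     landweber F G w u\<^sub>0 yd n +
     w n *\<^sub>R adjoint (blinfun_apply (G (landweber F G w u\<^sub>0 yd n))) (yd - F (landweber F G w u\<^sub>0 yd n))"

definition discrepancy_stop ::
  "('u::real_inner \<Rightarrow> 'y::real_inner) \<Rightarrow> ('u \<Rightarrow> 'u \<Rightarrow>\<^sub>L 'y) \<Rightarrow> (nat \<Rightarrow> real) \<Rightarrow> 'u \<Rightarrow>
    real \<Rightarrow> real \<Rightarrow> 'y \<Rightarrow> nat \<Rightarrow> bool" where
  "discrepancy_stop F G w u\<^sub>0 \<tau> \<delta> yd N \<longleftrightarrow>
     norm (yd - F (landweber F G w u\<^sub>0 yd N)) \<le> \<tau> * \<delta> \<and>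
     (\<forall>n<N. \<tau> * \<delta> < norm (yd - F (landweber F G w u\<^sub>0 yd n)))"

text \<open>At most one index satisfies the discrepancy principle; the value is unspecified if there is none.\<close>

definition stopping_index ::
  "('u::real_inner \<Rightarrow> 'y::real_inner) \<Rightarrow> ('u \<Rightarrow> 'u \<Rightarrow>\<^sub>L 'y) \<Rightarrow> (nat \<Rightarrow> real) \<Rightarrow> 'u \<Rightarrow>
    real \<Rightarrow> real \<Rightarrow> 'y \<Rightarrow> nat" where
  "stopping_index F G w u\<^sub>0 \<tau> \<delta> yd = (THE N. discrepancy_stop F G w u\<^sub>0 \<tau> \<delta> yd N)"

end

theory Submission
  imports Defs "HOL-Library.Diagonal_Subsequence"
begin

text \<open>
  The difficulty is that \<open>G\<close> need not be continuous, so for a fixed index the noisy iterate need not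
  depend continuously on the data, and the iterate for exact data need not be its limit as the noise
  vanishes.  Compactness supplies a substitute for that limit.

  As long as the residual exceeds \<open>\<tau> \<delta>\<close>, the tangential cone condition makes each step decrease the
  squared distance to every solution \<open>p\<close> in the ball by at least a fixed multiple of the squared
  residual (\<open>step_decrease\<close>).  Consequently the discrepancy principle stops, the iterates stay in
  the ball, and the residuals along the run are bounded independently of the noise.  The last
  fact and the bound on \<open>G\<^sub>u\<^sup>*\<close> as an operator into \<open>Z\<close> place the \<open>n\<close>-th iterates, for all
  noise levels at once, in \<open>u\<^sub>0\<close> plus one bounded subset of \<open>Z\<close>
  (\<open>iter_in_embedded_ball\<close>), which is relatively compact in \<open>U\<close>.  A diagonal argument yields a
  subsequence along which the \<open>n\<close>-th iterate, frozen once the iteration has stopped, converges to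
  some \<open>l n\<close> for every \<open>n\<close>.

  If for some \<open>n\<close> infinitely many stopping indices are at most \<open>n\<close>, the final iterates converge
  along a further subsequence to \<open>l n\<close>, which is a solution because the final residuals vanish.
  Otherwise the stopping indices tend to infinity, and two families of inequalities survive the
  limit: the decrease of the squared distance, and a bound by residuals for the inner products between an increment and
  the error at another index.  These do not mention \<open>G\<close> any more, and they force \<open>l\<close> to be Cauchy
  with vanishing residuals (\<open>fejer_increments_Cauchy\<close>), so \<open>l\<close> converges to a solution \<open>p\<close>.
  Finally, monotonicity of the distance to this very \<open>p\<close> controls the stopped iterate by the
  \<open>n\<close>-th one, for any fixed \<open>n\<close>: its distance to \<open>p\<close> is asymptotically at most that of \<open>l n\<close>,
  which is as small as desired.
\<close>

section \<open>Adjoints of bounded operators on Hilbert spaces\<close>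

text \<open>The representing vector is the minimiser of \<open>\<parallel>x\<parallel>\<^sup>2 - 2 f x\<close>: by the parallelogram law every minimising
  sequence of this strictly convex functional is Cauchy, and stationarity at the minimiser is the
  representation of \<open>f\<close>.\<close>

lemma riesz_representation:
  fixes f :: "'a::{real_inner,banach} \<Rightarrow> real"
  assumes "bounded_linear f"
  shows "\<exists>m. \<forall>h. f h = m \<bullet> h"
proof -
  interpret f: bounded_linear f by fact
  define J where "J x = (norm x)\<^sup>2 - 2 * f x" for x
  obtain K where K: "\<And>x. norm (f x) \<le> norm x * K"
    using f.bounded by blast
  have low: "- K\<^sup>2 \<le> J x" for x
  proof -
    have "f x \<le> norm x * K" using K[of x] by simp
    moreover have "0 \<le> (norm x - K)\<^sup>2" by simp
    ultimately show ?thesis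
      by (simp add: J_def power2_diff)
  qed
  define d where "d = Inf (range J)"
  have bdd: "bdd_below (range J)" using low by (auto intro!: bdd_belowI)
  have dle: "d \<le> J x" for x
    unfolding d_def by (rule cInf_lower) (auto simp: bdd)
  have "\<exists>x. J x < d + 1 / real (Suc n)" for n
  proof -
    have "Inf (range J) < d + 1 / real (Suc n)" by (simp add: d_def)
    then show ?thesis using cInf_less_iff[of "range J"] bdd by auto
  qed
  then obtain x where x: "\<And>n. J (x n) < d + 1 / real (Suc n)" by metis
  have par: "(norm (a - b))\<^sup>2 = 2 * J a + 2 * J b - 4 * J ((1/2) *\<^sub>R (a + b))" for a b
    by (simp add: J_def power2_norm_eq_inner f.scaleR f.add algebra_simps inner_commute)
  have close: "(norm (x m - x n))\<^sup>2 \<le> 2 / real (Suc m) + 2 / real (Suc n)" for m n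
    using par[of "x m" "x n"] x[of m] x[of n] dle[of "(1/2) *\<^sub>R (x m + x n)"] by simp
  have "Cauchy x"
  proof (rule CauchyI)
    fix e :: real assume e: "0 < e"
    obtain M where M: "4 / e\<^sup>2 < real M" using reals_Archimedean2 by blast
    have "norm (x m - x n) < e" if "m \<ge> M" "n \<ge> M" for m n
    proof -
      have M0: "0 < real M" using M e order.strict_trans[of 0 "4 / e\<^sup>2" "real M"] by simp
      have "2 / real (Suc m) \<le> 2 / real M" "2 / real (Suc n) \<le> 2 / real M"
        using that M0 by (auto intro!: divide_left_mono)
      then have "(norm (x m - x n))\<^sup>2 \<le> 4 / real M" using close[of m n] by linarith
      also have "\<dots> < e\<^sup>2" using M M0 e by (simp add: field_simps)
      finally show ?thesis using e by (simp add: power2_less_imp_less)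
    qed
    then show "\<exists>M. \<forall>m\<ge>M. \<forall>n\<ge>M. norm (x m - x n) < e" by blast
  qed
  then obtain m where m: "x \<longlonglongrightarrow> m" using Cauchy_convergent_iff convergent_def by blast
  have "(\<lambda>n. J (x n)) \<longlonglongrightarrow> J m"
    unfolding J_def by (intro tendsto_intros m f.tendsto)
  moreover have "(\<lambda>n. d + 1 / real (Suc n)) \<longlonglongrightarrow> d + 0"
    by (intro tendsto_intros LIMSEQ_Suc[OF lim_1_over_n])
  ultimately have Jm: "J m \<le> d"
    using x by (intro LIMSEQ_le[where X = "\<lambda>n. J (x n)"]) (auto intro!: less_imp_le)
  have "f h = m \<bullet> h" for h
  proof (rule ccontr)
    assume ne: "f h \<noteq> m \<bullet> h"
    define s where "s = f h - m \<bullet> h"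
    have s0: "s \<noteq> 0" using ne by (simp add: s_def)
    then have h0: "h \<noteq> 0" by (auto simp: s_def f.zero)
    \<comment> \<open>The step length that minimises \<open>J\<close> on the line through \<open>m\<close> in direction \<open>h\<close>.\<close>
    define t where "t = s / (h \<bullet> h)"
    have "(norm (m + t *\<^sub>R h))\<^sup>2 = (norm m)\<^sup>2 + 2 * t * (m \<bullet> h) + t\<^sup>2 * (h \<bullet> h)"
      by (simp add: power2_norm_eq_inner power2_eq_square[of t] algebra_simps inner_commute)
    then have "J (m + t *\<^sub>R h) = J m + t\<^sup>2 * (h \<bullet> h) - 2 * t * s"
      by (simp add: J_def s_def f.scaleR f.add algebra_simps)
    also have "\<dots> = J m - s\<^sup>2 / (h \<bullet> h)"
      using h0 by (simp add: t_def power2_eq_square)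
    also have "\<dots> < J m" using s0 h0 by simp
    finally show False using Jm dle[of "m + t *\<^sub>R h"] by linarith
  qed
  then show ?thesis by blast
qed

text \<open>The constant \<open>adjoint\<close> is a choice and says nothing unless an adjoint exists; the Riesz
  representation of the functionals \<open>h \<mapsto> A h \<bullet> z\<close> provides one without finite dimension.\<close>

lemma adjoint_blinfun_inner:
  fixes A :: "'a::{real_inner,banach} \<Rightarrow>\<^sub>L 'b::real_inner"
  shows "adjoint (blinfun_apply A) y \<bullet> x = y \<bullet> blinfun_apply A x"
proof -
  have "\<exists>m. \<forall>h. blinfun_apply A h \<bullet> z = m \<bullet> h" for z
    by (rule riesz_representation)
      (intro bounded_linear_compose[OF bounded_linear_inner_left] blinfun.bounded_linear_right)
  then obtain g where "\<forall>z h. blinfun_apply A h \<bullet> z = g z \<bullet> h" by metis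
  then have "\<forall>x z. blinfun_apply A x \<bullet> z = x \<bullet> g z" by (simp add: inner_commute)
  moreover from this have "adjoint (blinfun_apply A) = g" by (rule adjoint_unique)
  ultimately show ?thesis by (metis inner_commute)
qed

lemma norm_adjoint_blinfun_le:
  fixes A :: "'a::{real_inner,banach} \<Rightarrow>\<^sub>L 'b::real_inner"
  shows "norm (adjoint (blinfun_apply A) y) \<le> norm A * norm y"
proof -
  let ?a = "adjoint (blinfun_apply A) y"
  have "norm ?a * norm ?a = y \<bullet> blinfun_apply A ?a"
    unfolding power2_eq_square[symmetric] power2_norm_eq_inner by (rule adjoint_blinfun_inner)
  also have "\<dots> \<le> norm y * norm (blinfun_apply A ?a)" by (rule norm_cauchy_schwarz)
  also have "\<dots> \<le> norm y * (norm A * norm ?a)"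
    by (intro mult_left_mono norm_blinfun) auto
  finally show ?thesis
    by (cases "norm ?a = 0") (auto simp: mult_ac)
qed

section \<open>Convergence of Fejer monotone sequences with controlled increments\<close>

text \<open>Here \<open>e\<close> is an error sequence and \<open>r\<close> its residuals.  Expanding squares, the squared distance between
  \<open>e m\<close> and \<open>e l\<close> is a difference of squared norms plus an inner product of the accumulated
  increments with \<open>e l\<close>.  If \<open>l\<close> minimises the residual over a block of indices, each
  mixed product \<open>r i * r l\<close> in the bound for this inner product is at most \<open>(r i)\<^sup>2\<close>, and the sum of
  squares over the block is paid for by the decrease of the squared norm.  Passing through the
  minimising index thus bounds the distance between the two ends of any block by the decrease of a
  convergent sequence.\<close>

lemma fejer_increments_Cauchy:
  fixes e :: "nat \<Rightarrow> 'a::real_inner" and r :: "nat \<Rightarrow> real"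
  assumes c: "0 < c" and C: "0 \<le> C" and r: "\<And>n. 0 \<le> r n"
    and dec: "\<And>n. (norm (e (Suc n)))\<^sup>2 + c * (r n)\<^sup>2 \<le> (norm (e n))\<^sup>2"
    and cross: "\<And>i l. \<bar>(e (Suc i) - e i) \<bullet> e l\<bar> \<le> C * r i * (2 * r i + r l)"
  shows "Cauchy e" and "r \<longlonglongrightarrow> 0"
proof -
  define a where "a n = (norm (e n))\<^sup>2" for n
  have a_dec: "a (Suc n) \<le> a n" for n
    using dec[of n] mult_nonneg_nonneg[OF less_imp_le[OF c] zero_le_power2, of "r n"]
    unfolding a_def by linarith
  then have a_mono: "a q \<le> a p" if "p \<le> q" for p q
    using that by (simp add: lift_Suc_antimono_le)
  have sumr: "c * (\<Sum>i=p..<q. (r i)\<^sup>2) \<le> a p - a q" if "p \<le> q" for p q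
    using that
  proof (induction q rule: dec_induct)
    case (step q)
    then show ?case using dec[of q] by (simp add: a_def algebra_simps)
  qed simp
  define K where "K = 1 + 6 * C / c"
  have K: "K \<ge> 1" using c C by (simp add: K_def)
  have inc: "2 * \<bar>(e q - e p) \<bullet> e l\<bar> \<le> (K - 1) * (a p - a q)"
    if "p \<le> q" and min: "\<And>i. i \<in> {p..<q} \<Longrightarrow> r l \<le> r i" for p q l
  proof -
    have "e q - e p = (\<Sum>i=p..<q. e (Suc i) - e i)"
      using \<open>p \<le> q\<close> by (simp add: sum_Suc_diff')
    then have "\<bar>(e q - e p) \<bullet> e l\<bar> \<le> (\<Sum>i=p..<q. \<bar>(e (Suc i) - e i) \<bullet> e l\<bar>)"
      by (simp add: inner_sum_left sum_abs)
    also have "\<dots> \<le> (\<Sum>i=p..<q. 3 * C * (r i)\<^sup>2)"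
    proof (rule sum_mono)
      fix i assume "i \<in> {p..<q}"
      then have "C * r i * (2 * r i + r l) \<le> C * r i * (3 * r i)"
        using min[of i] C r[of i] by (intro mult_left_mono) auto
      then show "\<bar>(e (Suc i) - e i) \<bullet> e l\<bar> \<le> 3 * C * (r i)\<^sup>2"
        using cross[of i l] by (simp add: power2_eq_square mult_ac)
    qed
    also have "\<dots> = 3 * C / c * (c * (\<Sum>i=p..<q. (r i)\<^sup>2))"
      using c by (simp add: sum_distrib_left mult.assoc)
    also have "\<dots> \<le> 3 * C / c * (a p - a q)"
      using sumr[OF \<open>p \<le> q\<close>] c C by (intro mult_left_mono) auto
    finally show ?thesis by (simp add: K_def)
  qed
  have key: "(norm (e m - e n))\<^sup>2 \<le> 4 * K * (a n - a m)" if "n \<le> m" for n m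
  proof -
    \<comment> \<open>The intermediate index with the smallest residual of the block.\<close>
    define l where "l = arg_min_on r {n..m}"
    have l: "l \<in> {n..m}"
      unfolding l_def using \<open>n \<le> m\<close> by (intro arg_min_if_finite(1)) auto
    have lmin: "r l \<le> r i" if "i \<in> {n..m}" for i
      unfolding l_def using that by (intro arg_min_least) auto
    have nl: "n \<le> l" "l \<le> m" using l by auto
    have "(norm (e m - e l))\<^sup>2 = a m - a l - 2 * ((e m - e l) \<bullet> e l)"
      by (simp add: a_def power2_norm_eq_inner algebra_simps inner_commute)
    also have "\<dots> \<le> (K - 1) * (a l - a m)"
      using inc[of l m l] nl lmin a_mono[of l m] by (auto simp: abs_if split: if_splits)
    also have "\<dots> \<le> K * (a n - a m)"
      using K a_mono nl by (intro mult_mono) auto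
    finally have 1: "(norm (e m - e l))\<^sup>2 \<le> K * (a n - a m)" .
    have "(norm (e l - e n))\<^sup>2 = a n - a l + 2 * ((e l - e n) \<bullet> e l)"
      by (simp add: a_def power2_norm_eq_inner algebra_simps inner_commute)
    also have "\<dots> \<le> (a n - a l) + (K - 1) * (a n - a l)"
      using inc[of n l l] nl lmin by auto
    also have "\<dots> = K * (a n - a l)" by (simp add: algebra_simps)
    also have "\<dots> \<le> K * (a n - a m)"
      using K a_mono nl by (intro mult_left_mono) auto
    finally have 2: "(norm (e l - e n))\<^sup>2 \<le> K * (a n - a m)" .
    have "norm (e m - e n) \<le> norm (e m - e l) + norm (e l - e n)"
      using norm_triangle_ineq[of "e m - e l" "e l - e n"] by simp
    then have "(norm (e m - e n))\<^sup>2 \<le> (norm (e m - e l) + norm (e l - e n))\<^sup>2"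
      by (intro power_mono) auto
    also have "\<dots> \<le> 2 * (norm (e m - e l))\<^sup>2 + 2 * (norm (e l - e n))\<^sup>2"
      using zero_le_power2[of "norm (e m - e l) - norm (e l - e n)"]
      by (simp add: power2_sum power2_diff)
    finally show ?thesis using 1 2 by simp
  qed
  have "decseq a" by (simp add: decseq_Suc_iff a_dec)
  moreover have "\<forall>n. 0 \<le> a n" by (simp add: a_def)
  ultimately obtain A where A: "a \<longlonglongrightarrow> A" by (rule decseq_convergent)
  then have aC: "Cauchy a" by (rule LIMSEQ_imp_Cauchy)
  show "Cauchy e"
  proof (rule CauchyI')
    fix \<epsilon> :: real assume \<epsilon>: "0 < \<epsilon>"
    have "0 < \<epsilon>\<^sup>2 / (4 * K)" using \<epsilon> K by simp
    from CauchyD[OF aC this]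
    obtain M where M: "\<And>m n. m \<ge> M \<Longrightarrow> n \<ge> M \<Longrightarrow> norm (a m - a n) < \<epsilon>\<^sup>2 / (4 * K)" by blast
    have "dist (e n) (e m) < \<epsilon>" if "n \<ge> M" "m > n" for n m
    proof -
      have "a n - a m < \<epsilon>\<^sup>2 / (4 * K)" using M[of n m] that by simp
      then have "4 * K * (a n - a m) < \<epsilon>\<^sup>2" using K by (simp add: field_simps)
      then have "(norm (e m - e n))\<^sup>2 < \<epsilon>\<^sup>2" using key[of n m] that by simp
      then show ?thesis using \<epsilon> power2_less_imp_less[of "norm (e m - e n)" \<epsilon>] by (simp add: dist_norm norm_minus_commute)
    qed
    then show "\<exists>M. \<forall>m\<ge>M. \<forall>n>m. dist (e m) (e n) < \<epsilon>" by blast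
  qed
  have "(\<lambda>n. (a n - a (Suc n)) / c) \<longlonglongrightarrow> (A - A) / c"
    using c by (intro tendsto_intros A LIMSEQ_Suc[OF A]) auto
  then have lim: "(\<lambda>n. (a n - a (Suc n)) / c) \<longlonglongrightarrow> 0" by simp
  have "(r n)\<^sup>2 \<le> (a n - a (Suc n)) / c" for n
    using dec[of n] c by (simp add: a_def pos_le_divide_eq mult.commute)
  then have "\<forall>\<^sub>F n in sequentially. norm ((r n)\<^sup>2) \<le> (a n - a (Suc n)) / c"
    by (intro always_eventually allI) simp
  then have "(\<lambda>n. (r n)\<^sup>2) \<longlonglongrightarrow> 0" using lim by (rule Lim_null_comparison)
  then have "(\<lambda>n. sqrt ((r n)\<^sup>2)) \<longlonglongrightarrow> sqrt 0" by (rule tendsto_real_sqrt)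
  then show "r \<longlonglongrightarrow> 0" using r by simp
qed

section \<open>The noisy iteration up to the stopping index\<close>

text \<open>The data that govern a single run, on the ball where both the operator bound and the tangential
  cone condition hold; \<open>gap\<close> is what makes a step with residual above \<open>\<tau> \<delta>\<close> profitable.\<close>

locale landweber_cone =
  fixes F :: "'u::{real_inner,banach} \<Rightarrow> 'y::real_inner"
    and G :: "'u \<Rightarrow> 'u \<Rightarrow>\<^sub>L 'y"
    and u\<^sub>d u\<^sub>0 :: 'u and w :: "nat \<Rightarrow> real"
    and L \<rho> \<mu> \<tau> lam \<Lambda> :: real
  assumes G_bound: "\<And>u. u \<in> cball u\<^sub>d \<rho> \<Longrightarrow> norm (G u) \<le> L"
    and cone: "\<And>u u'. u \<in> cball u\<^sub>d \<rho> \<Longrightarrow> u' \<in> cball u\<^sub>d \<rho> \<Longrightarrow>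
      norm (F u' - F u - G u (u' - u)) \<le> \<mu> * norm (F u' - F u)"
    and \<rho>: "0 < \<rho>" and \<mu>: "0 \<le> \<mu>" and \<tau>: "0 < \<tau>" and lam: "0 < lam"
    and gap: "2 * (\<mu> + 1) / \<tau> - (2 - 2 * \<mu> - \<Lambda> * L\<^sup>2) < 0"
    and start: "u\<^sub>0 \<in> cball u\<^sub>d \<rho>"
    and steps: "\<And>n. w n \<in> {lam..\<Lambda>}"
begin

text \<open>The constant in the decrease of the squared distance: the smallest step size times the margin in
  \<open>gap\<close>.\<close>

definition c :: real where
  "c = lam * (2 - 2 * \<mu> - \<Lambda> * L\<^sup>2 - 2 * (\<mu> + 1) / \<tau>)"

abbreviation iter :: "'y \<Rightarrow> nat \<Rightarrow> 'u" where
  "iter yd n \<equiv> landweber F G w u\<^sub>0 yd n"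

abbreviation stop :: "real \<Rightarrow> 'y \<Rightarrow> nat" where
  "stop \<delta> yd \<equiv> stopping_index F G w u\<^sub>0 \<tau> \<delta> yd"

lemma c_pos: "0 < c"
  using gap lam by (simp add: c_def)

lemma L_nonneg: "0 \<le> L"
  using G_bound[OF start] norm_ge_zero order_trans by blast

text \<open>Moving the adjoint over, the cross term of the expanded square is \<open>r \<bullet> G u (u - p)\<close> with
  \<open>r\<close> the residual.  Up to the noise and the linearisation error, \<open>G u (u - p)\<close> equals \<open>- r\<close>; both
  deviations are bounded by multiples of \<open>norm r\<close>, the noise because \<open>\<delta> < norm r / \<tau>\<close>.  The
  quadratic term costs at most \<open>\<Lambda> L\<^sup>2\<close> per unit step.  The solution \<open>p\<close> is arbitrary in the ball,
  because the estimate is needed both for the centre and for the eventual limit.\<close>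

lemma step_decrease:
  assumes u: "u \<in> cball u\<^sub>d \<rho>" and p: "p \<in> cball u\<^sub>d \<rho>" "F p = F u\<^sub>d"
    and noise: "norm (yd - F u\<^sub>d) \<le> \<delta>" and res: "\<tau> * \<delta> < norm (yd - F u)"
    and s: "s \<in> {lam..\<Lambda>}"
  shows "(norm (u + s *\<^sub>R adjoint (G u) (yd - F u) - p))\<^sup>2 + c * (norm (yd - F u))\<^sup>2
    \<le> (norm (u - p))\<^sup>2"
proof -
  define r where "r = yd - F u"
  define a where "a = adjoint (G u) r"
  define q where "q = (yd - F p) + (F p - F u - G u (p - u))"
  define R where "R = norm r"
  define \<kappa> where "\<kappa> = 2 - 2 * \<mu> - \<Lambda> * L\<^sup>2 - 2 * (\<mu> + 1) / \<tau>"
  have s0: "0 < s" "lam \<le> s" "s \<le> \<Lambda>" using s lam by auto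
  have R0: "0 \<le> R" by (simp add: R_def)
  have \<delta>: "\<delta> \<le> R / \<tau>" using res \<tau> by (simp add: R_def r_def field_simps)
  have "G u (u - p) = q - r"
    by (simp add: r_def q_def blinfun.diff_right)
  moreover have "a \<bullet> (u - p) = r \<bullet> G u (u - p)"
    by (simp only: a_def adjoint_blinfun_inner)
  ultimately have "a \<bullet> (u - p) = - R\<^sup>2 + r \<bullet> q"
    by (simp only: inner_diff_right R_def power2_norm_eq_inner)
  moreover have "r \<bullet> q \<le> R * (\<mu> * R + (1 + \<mu>) * (R / \<tau>))"
  proof -
    have "norm (F p - F u) \<le> R + \<delta>"
      using norm_triangle_ineq4[of "yd - F u" "yd - F u\<^sub>d"] noise by (simp add: p R_def r_def)
    then have "\<mu> * norm (F p - F u) \<le> \<mu> * (R + \<delta>)" using \<mu> by (rule mult_left_mono)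
    then have "norm q \<le> \<delta> + \<mu> * (R + \<delta>)"
      using norm_triangle_ineq[of "yd - F p" "F p - F u - G u (p - u)"] cone[OF u p(1)] noise
      by (simp add: q_def p)
    also have "\<dots> = \<mu> * R + (1 + \<mu>) * \<delta>" by (simp add: algebra_simps)
    also have "\<dots> \<le> \<mu> * R + (1 + \<mu>) * (R / \<tau>)"
      using \<delta> \<mu> by (intro add_left_mono mult_left_mono) auto
    finally have "R * norm q \<le> R * (\<mu> * R + (1 + \<mu>) * (R / \<tau>))"
      using R0 by (rule mult_left_mono)
    then show ?thesis using norm_cauchy_schwarz[of r q] by (simp add: R_def)
  qed
  ultimately have inn: "a \<bullet> (u - p) \<le> R\<^sup>2 * (\<mu> - 1 + (1 + \<mu>) / \<tau>)"
    by (simp add: algebra_simps power2_eq_square)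
  have "norm a \<le> L * R"
    using norm_adjoint_blinfun_le[of "G u" r] mult_right_mono[OF G_bound[OF u], of R] R0
    by (simp add: a_def R_def)
  then have na: "(norm a)\<^sup>2 \<le> L\<^sup>2 * R\<^sup>2"
    using power_mono[of "norm a" "L * R" 2] by (simp add: power_mult_distrib)
  have "(norm (u + s *\<^sub>R a - p))\<^sup>2 = (norm (u - p))\<^sup>2 + 2 * s * (a \<bullet> (u - p)) + s * (s * (norm a)\<^sup>2)"
    by (simp add: power2_norm_eq_inner algebra_simps inner_commute)
  also have "\<dots> \<le> (norm (u - p))\<^sup>2 + 2 * s * (R\<^sup>2 * (\<mu> - 1 + (1 + \<mu>) / \<tau>)) + s * (\<Lambda> * (L\<^sup>2 * R\<^sup>2))"
    using inn na s0 by (intro add_mono mult_left_mono mult_mono) auto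
  also have "\<dots> = (norm (u - p))\<^sup>2 - s * (\<kappa> * R\<^sup>2)"
    by (simp add: \<kappa>_def algebra_simps add_divide_distrib)
  also have "\<dots> \<le> (norm (u - p))\<^sup>2 - lam * (\<kappa> * R\<^sup>2)"
    using s0 gap by (intro diff_left_mono mult_right_mono) (auto simp: \<kappa>_def)
  finally show ?thesis by (simp add: a_def r_def R_def c_def \<kappa>_def)
qed

lemma step_stays:
  assumes "u \<in> cball u\<^sub>d \<rho>" "norm (yd - F u\<^sub>d) \<le> \<delta>" "\<tau> * \<delta> < norm (yd - F u)" "s \<in> {lam..\<Lambda>}"
  shows "u + s *\<^sub>R adjoint (G u) (yd - F u) \<in> cball u\<^sub>d \<rho>"
proof -
  have "(norm (u + s *\<^sub>R adjoint (G u) (yd - F u) - u\<^sub>d))\<^sup>2 \<le> (norm (u - u\<^sub>d))\<^sup>2"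
    using step_decrease[OF assms(1) centre_in_cball[THEN iffD2, OF less_imp_le[OF \<rho>]] refl assms(2-4)]
      mult_nonneg_nonneg[OF less_imp_le[OF c_pos] zero_le_power2, of "norm (yd - F u)"]
    by linarith
  then have "norm (u + s *\<^sub>R adjoint (G u) (yd - F u) - u\<^sub>d) \<le> norm (u - u\<^sub>d)"
    by (rule power2_le_imp_le) simp
  then show ?thesis using assms(1) by (simp add: dist_norm norm_minus_commute)
qed

lemma iter_in_cball:
  assumes "norm (yd - F u\<^sub>d) \<le> \<delta>" "\<And>i. i < n \<Longrightarrow> \<tau> * \<delta> < norm (yd - F (iter yd i))"
  shows "iter yd n \<in> cball u\<^sub>d \<rho>"
  using assms(2)
proof (induction n)
  case (Suc n)
  then show ?case using step_stays[OF _ assms(1) _ steps] by simp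
qed (use start in simp)

text \<open>Each step before stopping consumes at least \<open>c (\<tau> \<delta>)\<^sup>2\<close> of the initial squared error, so only
  finitely many are possible.\<close>

lemma discrepancy_stop_exists:
  assumes \<delta>: "0 < \<delta>" and noise: "norm (yd - F u\<^sub>d) \<le> \<delta>"
  shows "\<exists>N. discrepancy_stop F G w u\<^sub>0 \<tau> \<delta> yd N"
proof -
  have "\<exists>n. norm (yd - F (iter yd n)) \<le> \<tau> * \<delta>"
  proof (rule ccontr)
    assume "\<nexists>n. norm (yd - F (iter yd n)) \<le> \<tau> * \<delta>"
    then have big: "\<tau> * \<delta> < norm (yd - F (iter yd n))" for n by (simp add: not_le)
    define b where "b = c * (\<tau> * \<delta>)\<^sup>2"
    have b: "0 < b" using c_pos \<tau> \<delta> by (simp add: b_def)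
    have upper: "(norm (iter yd n - u\<^sub>d))\<^sup>2 + real n * b \<le> (norm (u\<^sub>0 - u\<^sub>d))\<^sup>2" for n
    proof (induction n)
      case (Suc n)
      have "b \<le> c * (norm (yd - F (iter yd n)))\<^sup>2"
        using big[of n] c_pos \<tau> \<delta> unfolding b_def
        by (intro mult_left_mono power_mono) auto
      moreover have "(norm (iter yd (Suc n) - u\<^sub>d))\<^sup>2 + c * (norm (yd - F (iter yd n)))\<^sup>2
          \<le> (norm (iter yd n - u\<^sub>d))\<^sup>2"
        using step_decrease[OF iter_in_cball[OF noise big] _ refl noise big steps] \<rho> by simp
      ultimately show ?case using Suc by (simp add: algebra_simps)
    qed simp
    obtain n where "(norm (u\<^sub>0 - u\<^sub>d))\<^sup>2 / b < real n" using reals_Archimedean2 by blast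
    then have "(norm (u\<^sub>0 - u\<^sub>d))\<^sup>2 < real n * b"
      using b by (simp add: pos_divide_less_eq)
    then show False
      using upper[of n] zero_le_power2[of "norm (iter yd n - u\<^sub>d)"] by linarith
  qed
  then obtain N where "norm (yd - F (iter yd N)) \<le> \<tau> * \<delta>"
    "\<forall>n<N. \<not> norm (yd - F (iter yd n)) \<le> \<tau> * \<delta>"
    using exists_least_iff[of "\<lambda>n. norm (yd - F (iter yd n)) \<le> \<tau> * \<delta>"] by blast
  then show ?thesis unfolding discrepancy_stop_def by (metis not_le)
qed

lemma stopping_index_satisfies:
  assumes "0 < \<delta>" "norm (yd - F u\<^sub>d) \<le> \<delta>"
  shows "discrepancy_stop F G w u\<^sub>0 \<tau> \<delta> yd (stop \<delta> yd)"
proof -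
  obtain N where N: "discrepancy_stop F G w u\<^sub>0 \<tau> \<delta> yd N"
    using discrepancy_stop_exists[OF assms] by blast
  have uniq: "M = N" if "discrepancy_stop F G w u\<^sub>0 \<tau> \<delta> yd M" for M
    using that N unfolding discrepancy_stop_def by (metis linorder_neqE_nat not_le)
  show ?thesis
    unfolding stopping_index_def by (rule theI[where P = "discrepancy_stop F G w u\<^sub>0 \<tau> \<delta> yd", OF N uniq])
qed

context
  fixes \<delta> :: real and yd :: 'y
  assumes \<delta>: "0 < \<delta>" and noise: "norm (yd - F u\<^sub>d) \<le> \<delta>"
begin

lemma residual_at_stop: "norm (yd - F (iter yd (stop \<delta> yd))) \<le> \<tau> * \<delta>"
  using stopping_index_satisfies[OF \<delta> noise] by (simp add: discrepancy_stop_def)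

lemma residual_before_stop: "n < stop \<delta> yd \<Longrightarrow> \<tau> * \<delta> < norm (yd - F (iter yd n))"
  using stopping_index_satisfies[OF \<delta> noise] by (simp add: discrepancy_stop_def)

lemma iter_mem: "n \<le> stop \<delta> yd \<Longrightarrow> iter yd n \<in> cball u\<^sub>d \<rho>"
  by (rule iter_in_cball[OF noise]) (simp add: residual_before_stop)

lemma iter_decrease:
  assumes "n < stop \<delta> yd" "p \<in> cball u\<^sub>d \<rho>" "F p = F u\<^sub>d"
  shows "(norm (iter yd (Suc n) - p))\<^sup>2 + c * (norm (yd - F (iter yd n)))\<^sup>2
    \<le> (norm (iter yd n - p))\<^sup>2"
  using step_decrease[OF iter_mem assms(2,3) noise residual_before_stop steps] assms(1) by simp

lemma iter_fejer:
  assumes "n \<le> stop \<delta> yd" "p \<in> cball u\<^sub>d \<rho>" "F p = F u\<^sub>d"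
  shows "norm (iter yd (stop \<delta> yd) - p) \<le> norm (iter yd n - p)"
  using assms(1)
proof (induction n rule: inc_induct)
  case (step n)
  have "(norm (iter yd (Suc n) - p))\<^sup>2 \<le> (norm (iter yd n - p))\<^sup>2"
    using iter_decrease[OF step(2) assms(2,3)]
      mult_nonneg_nonneg[OF less_imp_le[OF c_pos] zero_le_power2, of "norm (yd - F (iter yd n))"]
    by linarith
  then have "norm (iter yd (Suc n) - p) \<le> norm (iter yd n - p)"
    by (rule power2_le_imp_le) simp
  then show ?case using step by simp
qed simp

text \<open>A single step already turns the residual into a decrease of a squared distance that is at most
  \<open>\<rho>\<^sup>2\<close>.  The bound does not depend on \<open>\<delta>\<close>, which is the point.\<close>

lemma residual_bound:
  assumes "n < stop \<delta> yd"
  shows "norm (yd - F (iter yd n)) \<le> \<rho> / sqrt c"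
proof -
  have "c * (norm (yd - F (iter yd n)))\<^sup>2 \<le> (norm (iter yd n - u\<^sub>d))\<^sup>2"
    using iter_decrease[OF assms _ refl] \<rho>
      zero_le_power2[of "norm (iter yd (Suc n) - u\<^sub>d)"]
    by (simp del: landweber.simps zero_le_power2, linarith)
  also have "\<dots> \<le> \<rho>\<^sup>2"
    using iter_mem[of n] assms by (intro power_mono) (auto simp: dist_norm norm_minus_commute)
  finally have "(norm (yd - F (iter yd n)))\<^sup>2 \<le> (\<rho> / sqrt c)\<^sup>2"
    using c_pos by (simp add: power_divide field_simps)
  then show ?thesis by (rule power2_le_imp_le) (use \<rho> c_pos in auto)
qed

text \<open>The cone condition gives \<open>norm (G u (h - u)) \<le> (1 + \<mu>) * norm (F h - F u)\<close>.  Applied at the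
  \<open>i\<close>-th iterate with \<open>h\<close> the \<open>l\<close>-th iterate and with \<open>h = u\<^sub>d\<close>, it replaces the derivative by
  values of \<open>F\<close>, so that the resulting inequality can be passed to the limit even though \<open>G\<close> is not
  continuous.\<close>

lemma increment_cross_bound:
  assumes i: "i < stop \<delta> yd" and l: "l \<le> stop \<delta> yd"
  shows "\<bar>(iter yd (Suc i) - iter yd i) \<bullet> (iter yd l - u\<^sub>d)\<bar>
    \<le> \<Lambda> * (1 + \<mu>) * norm (yd - F (iter yd i)) *
       (2 * norm (F (iter yd i) - F u\<^sub>d) + norm (F (iter yd l) - F u\<^sub>d))"
proof -
  let ?u = "iter yd i" and ?v = "iter yd l"
  let ?r = "yd - F ?u" and ?g = "G ?u (?v - u\<^sub>d)"
  have lin: "norm (G ?u (h - ?u)) \<le> (1 + \<mu>) * norm (F h - F ?u)" if "h \<in> cball u\<^sub>d \<rho>" for h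
  proof -
    have "norm (G ?u (h - ?u)) \<le> norm (F h - F ?u) + norm (F h - F ?u - G ?u (h - ?u))"
      by (rule norm_triangle_sub[of "G ?u (h - ?u)" "F h - F ?u", unfolded norm_minus_commute[of "G ?u (h - ?u)"]])
    then show ?thesis
      using cone[OF iter_mem[OF less_imp_le[OF i]] that] unfolding distrib_right mult_1 by linarith
  qed
  have "?g = G ?u (?v - ?u) - G ?u (u\<^sub>d - ?u)" by (simp add: blinfun.diff_right)
  then have "norm ?g \<le> (1 + \<mu>) * norm (F ?v - F ?u) + (1 + \<mu>) * norm (F u\<^sub>d - F ?u)"
    using lin[OF iter_mem[OF l]] lin[of u\<^sub>d] \<rho>
      norm_triangle_ineq4[of "G ?u (?v - ?u)" "G ?u (u\<^sub>d - ?u)"] by simp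
  also have "\<dots> = (1 + \<mu>) * (norm (F ?v - F ?u) + norm (F ?u - F u\<^sub>d))"
    by (simp add: algebra_simps norm_minus_commute)
  also have "\<dots> \<le> (1 + \<mu>) * (2 * norm (F ?u - F u\<^sub>d) + norm (F ?v - F u\<^sub>d))"
    using norm_triangle_ineq4[of "F ?v - F u\<^sub>d" "F ?u - F u\<^sub>d"] \<mu>
    by (intro mult_left_mono) auto
  finally have g: "norm ?g \<le> (1 + \<mu>) * (2 * norm (F ?u - F u\<^sub>d) + norm (F ?v - F u\<^sub>d))" .
  have w: "0 \<le> w i" "w i \<le> \<Lambda>" using steps[of i] lam by auto
  have "\<bar>(iter yd (Suc i) - ?u) \<bullet> (?v - u\<^sub>d)\<bar> = w i * \<bar>?r \<bullet> ?g\<bar>"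
    using w by (simp add: adjoint_blinfun_inner abs_mult)
  also have "\<dots> \<le> \<Lambda> * (norm ?r * norm ?g)"
    using w by (intro mult_mono Cauchy_Schwarz_ineq2) auto
  also have "\<dots> \<le> \<Lambda> * (norm ?r * ((1 + \<mu>) * (2 * norm (F ?u - F u\<^sub>d) + norm (F ?v - F u\<^sub>d))))"
    using w g by (intro mult_left_mono) auto
  finally show ?thesis by (simp add: mult_ac)
qed

text \<open>Every increment before stopping lies in \<open>Z\<close> with a norm bounded independently of \<open>\<delta>\<close>, so the radius grows
  linearly in \<open>n\<close> but is common to all noise levels.\<close>

lemma iter_in_embedded_ball:
  assumes emb: "compact_embedding j"
    and ran: "\<And>u. range (adjoint (G u)) \<subseteq> range j"
    and Lh: "\<And>u. u \<in> cball u\<^sub>d \<rho> \<Longrightarrow> bounded_linear (\<lambda>x. inv j (adjoint (G u) x)) \<and>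
           onorm (\<lambda>x. inv j (adjoint (G u) x)) \<le> Lh"
    and n: "n \<le> stop \<delta> yd"
  shows "\<exists>z. norm z \<le> real n * (\<Lambda> * (Lh * (\<rho> / sqrt c))) \<and> iter yd n = u\<^sub>0 + j z"
  using n
proof (induction n)
  interpret j: bounded_linear j using emb by (simp add: compact_embedding_def)
  case 0
  then show ?case by (intro exI[of _ 0]) (simp add: j.zero)
next
  interpret j: bounded_linear j using emb by (simp add: compact_embedding_def)
  case (Suc n)
  then obtain z where z: "norm z \<le> real n * (\<Lambda> * (Lh * (\<rho> / sqrt c)))" "iter yd n = u\<^sub>0 + j z"
    by auto
  let ?r = "yd - F (iter yd n)"
  let ?f = "\<lambda>x. inv j (adjoint (G (iter yd n)) x)"
  have bl: "bounded_linear ?f" and on: "onorm ?f \<le> Lh"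
    using Lh[OF iter_mem, of n] Suc.prems by auto
  have "adjoint (G (iter yd n)) ?r \<in> range j" using ran by blast
  then have jf: "j (?f ?r) = adjoint (G (iter yd n)) ?r" by (rule f_inv_into_f)
  have w: "0 \<le> w n" "w n \<le> \<Lambda>" using steps[of n] lam by auto
  have "norm (?f ?r) \<le> onorm ?f * norm ?r" by (rule onorm[OF bl])
  also have "\<dots> \<le> Lh * (\<rho> / sqrt c)"
    using on residual_bound[of n] Suc.prems onorm_pos_le[OF bl]
    by (intro mult_mono) auto
  finally have "norm (w n *\<^sub>R ?f ?r) \<le> \<Lambda> * (Lh * (\<rho> / sqrt c))"
    unfolding norm_scaleR using w by (intro mult_mono) auto
  then have "norm (z + w n *\<^sub>R ?f ?r) \<le> real (Suc n) * (\<Lambda> * (Lh * (\<rho> / sqrt c)))"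
    using z(1) norm_triangle_ineq[of z "w n *\<^sub>R ?f ?r"]
    unfolding of_nat_Suc distrib_right mult_1 by linarith
  moreover have "iter yd (Suc n) = u\<^sub>0 + j (z + w n *\<^sub>R ?f ?r)"
    by (simp add: z(2) [symmetric] jf j.add j.scaleR add.assoc[symmetric] del: add.assoc)
  ultimately show ?case by blast
qed

end

end

section \<open>Extraction of a convergent subsequence\<close>

lemma completely_continuous_tendsto:
  assumes "completely_continuous F" and "x \<longlonglongrightarrow> l"
  shows "(\<lambda>n. F (x n)) \<longlonglongrightarrow> F l"
proof -
  have "weakly_converges x l"
    unfolding weakly_converges_def using bounded_linear.tendsto[OF _ assms(2)] by blast
  then show ?thesis using assms(1) unfolding completely_continuous_def by blast
qed

lemma diagonal_subsequence_compact:
  fixes x :: "nat \<Rightarrow> nat \<Rightarrow> 'a::metric_space"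
  assumes K: "\<And>n. compact (K n)" and x: "\<And>k n. x k n \<in> K n"
  shows "\<exists>s::nat \<Rightarrow> nat. strict_mono s \<and> (\<exists>l. \<forall>n. (\<lambda>k. x (s k) n) \<longlonglongrightarrow> l n)"
proof -
  interpret subseqs "\<lambda>n s. convergent (\<lambda>k. x (s k) n)"
  proof
    fix n and s :: "nat \<Rightarrow> nat"
    assume "strict_mono s"
    have "seq_compact (K n)" using K by (rule compact_imp_seq_compact)
    then have "\<exists>l\<in>K n. \<exists>r::nat \<Rightarrow> nat. strict_mono r \<and> ((\<lambda>k. x (s k) n) \<circ> r) \<longlonglongrightarrow> l"
      by (rule seq_compact_def[THEN iffD1, THEN spec, THEN mp]) (simp add: x)
    then show "\<exists>r'. strict_mono r' \<and> convergent (\<lambda>k. x ((s \<circ> r') k) n)"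
      unfolding convergent_def o_def by blast
  qed
  have "convergent (\<lambda>k. x (diagseq k) n)" for n
  proof -
    have "convergent (\<lambda>k. x ((diagseq \<circ> ((+) (Suc n))) k) n)"
    proof (rule diagseq_holds)
      fix r s :: "nat \<Rightarrow> nat" and m
      assume "strict_mono r" "convergent (\<lambda>k. x (s k) m)"
      then show "convergent (\<lambda>k. x ((s \<circ> r) k) m)"
        using convergent_subseq_convergent[of "\<lambda>k. x (s k) m" r] by (simp add: o_def)
    qed
    then have "convergent (\<lambda>k. x (diagseq (k + Suc n)) n)"
      unfolding o_def by (subst add.commute)
    then show ?thesis
      using convergent_ignore_initial_segment[of "\<lambda>k. x (diagseq k) n" "Suc n"] by simp
  qed
  then have "(\<lambda>k. x (diagseq k) n) \<longlonglongrightarrow> lim (\<lambda>k. x (diagseq k) n)" for n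
    by (simp add: convergent_LIMSEQ_iff)
  then show ?thesis
    by (intro exI[of _ diagseq] conjI subseq_diagseq exI[of _ "\<lambda>n. lim (\<lambda>k. x (diagseq k) n)"] allI)
qed

context landweber_cone
begin

text \<open>The iterate at index \<open>min n (N k)\<close>, called \<open>x k n\<close> below, agrees with the \<open>n\<close>-th iterate
  before stopping and with the final one afterwards.  It is therefore defined and controlled for all
  \<open>n\<close> and \<open>k\<close>, and it serves both bounded and unbounded stopping indices.\<close>

lemma exists_strongly_convergent_subsequence:
  fixes j :: "'z::real_normed_vector \<Rightarrow> 'u" and \<delta> :: "nat \<Rightarrow> real"
  assumes cc: "completely_continuous F"
    and emb: "compact_embedding j"
    and ran: "\<And>u. range (adjoint (G u)) \<subseteq> range j"
    and Lh: "\<And>u. u \<in> cball u\<^sub>d \<rho> \<Longrightarrow> bounded_linear (\<lambda>x. inv j (adjoint (G u) x)) \<and>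
           onorm (\<lambda>x. inv j (adjoint (G u) x)) \<le> Lh"
    and \<delta>: "\<And>k. 0 < \<delta> k" and \<delta>0: "\<delta> \<longlonglongrightarrow> 0"
    and noise: "\<And>k. norm (y k - F u\<^sub>d) \<le> \<delta> k"
  shows "\<exists>s. strict_mono s \<and> (\<exists>ub\<in>solution_set F u\<^sub>d \<rho>.
    (\<lambda>k. iter (y (s k)) (stop (\<delta> (s k)) (y (s k)))) \<longlonglongrightarrow> ub)"
proof -
  define N where "N k = stop (\<delta> k) (y k)" for k
  define v where "v k = iter (y k) (N k)" for k
  define x where "x k n = iter (y k) (min n (N k))" for k n
  define B where "B = \<Lambda> * (Lh * (\<rho> / sqrt c))"
  define K where "K n = (+) u\<^sub>0 ` closure (j ` cball 0 (real n * B))" for n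
  have Lh0: "0 \<le> Lh" using Lh[OF start] onorm_pos_le order_trans by blast
  have \<Lambda>0: "0 \<le> \<Lambda>" using steps[of 0] lam by auto
  have B0: "0 \<le> B" using Lh0 \<Lambda>0 \<rho> c_pos by (simp add: B_def)
  have cK: "compact (K n)" for n
    using emb unfolding K_def compact_embedding_def
    by (intro compact_continuous_image) (auto intro!: continuous_intros)
  have xK: "x k n \<in> K n" for k n
  proof -
    have le: "min n (N k) \<le> stop (\<delta> k) (y k)" by (simp add: N_def)
    obtain z where z: "norm z \<le> real (min n (N k)) * B" "x k n = u\<^sub>0 + j z"
      using iter_in_embedded_ball[OF \<delta> noise emb ran Lh le] unfolding x_def B_def by blast
    have "real (min n (N k)) * B \<le> real n * B" using B0 by (intro mult_right_mono) auto
    then have "z \<in> cball 0 (real n * B)" using z(1) unfolding mem_cball_0 by linarith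
    then have "j z \<in> closure (j ` cball 0 (real n * B))"
      by (intro subsetD[OF closure_subset] imageI)
    then show ?thesis using z(2) by (simp add: K_def)
  qed
  from diagonal_subsequence_compact[where K = K and x = x, OF cK xK]
  obtain s l where s: "strict_mono s" and l_all: "\<forall>n. (\<lambda>k. x (s k) n) \<longlonglongrightarrow> l n"
    by (elim exE conjE)
  have l: "(\<lambda>k. x (s k) n) \<longlonglongrightarrow> l n" for n
    using l_all by (rule spec)
  have ys: "(\<lambda>k. y k) \<longlonglongrightarrow> F u\<^sub>d"
  proof (rule LIM_zero_cancel, rule Lim_null_comparison[OF _ \<delta>0])
    show "\<forall>\<^sub>F k in sequentially. norm (y k - F u\<^sub>d) \<le> \<delta> k" using noise by simp
  qed
  have Fv: "(\<lambda>k. F (v k)) \<longlonglongrightarrow> F u\<^sub>d"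
  proof -
    have "(\<lambda>k. y k - F (v k)) \<longlonglongrightarrow> 0"
    proof (rule Lim_null_comparison)
      show "\<forall>\<^sub>F k in sequentially. norm (y k - F (v k)) \<le> \<tau> * \<delta> k"
        using residual_at_stop[OF \<delta> noise] by (simp add: v_def N_def)
      show "(\<lambda>k. \<tau> * \<delta> k) \<longlonglongrightarrow> 0" using tendsto_mult_right_zero[OF \<delta>0] .
    qed
    from tendsto_diff[OF ys this] show ?thesis by simp
  qed
  have xball: "x k n \<in> cball u\<^sub>d \<rho>" for k n
    using iter_mem[OF \<delta> noise, of "min n (N k)" k] by (simp add: x_def N_def)
  have lball: "l n \<in> cball u\<^sub>d \<rho>" for n
    by (rule closed_sequentially[OF closed_cball _ l]) (rule xball)
  have Fl: "(\<lambda>k. F (x (s k) n)) \<longlonglongrightarrow> F (l n)" for n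
    by (rule completely_continuous_tendsto[OF cc l])
  have yss: "(\<lambda>k. y (s k)) \<longlonglongrightarrow> F u\<^sub>d" using LIMSEQ_subseq_LIMSEQ[OF ys s] by (simp add: o_def)
  have Fvs: "(\<lambda>k. F (v (s k))) \<longlonglongrightarrow> F u\<^sub>d" using LIMSEQ_subseq_LIMSEQ[OF Fv s] by (simp add: o_def)
  show ?thesis
  proof (cases "\<exists>n. \<exists>\<^sub>F k in sequentially. N (s k) \<le> n")
    case True
    then obtain n where "infinite {k. N (s k) \<le> n}"
      by (auto simp: frequently_cofinite simp flip: cofinite_eq_sequentially)
    then obtain r :: "nat \<Rightarrow> nat" where r: "strict_mono r" and rn: "\<And>k. N (s (r k)) \<le> n"
      using infinite_enumerate by blast
    have "x (s (r k)) n = v (s (r k))" for k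
      using rn[of k] by (simp add: x_def v_def min_absorb2)
    then have vl: "(\<lambda>k. v (s (r k))) \<longlonglongrightarrow> l n"
      using LIMSEQ_subseq_LIMSEQ[OF l r, of n] by (simp add: o_def)
    have "F (l n) = F u\<^sub>d"
      using completely_continuous_tendsto[OF cc vl] LIMSEQ_subseq_LIMSEQ[OF Fvs r]
      by (intro LIMSEQ_unique) (auto simp: o_def)
    then have "l n \<in> solution_set F u\<^sub>d \<rho>" using lball by (simp add: solution_set_def)
    moreover have "strict_mono (s \<circ> r)" using s r by (rule strict_mono_o)
    ultimately show ?thesis using vl unfolding v_def N_def
      by (intro exI[of _ "s \<circ> r"]) (auto simp: o_def)
  next
    case False
    then have late: "\<forall>\<^sub>F k in sequentially. n < N (s k)" for n
      by (simp add: not_frequently not_le)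
    have x_eq: "x k n = iter (y k) n" if "n \<le> N k" for k n
      using that by (simp add: x_def min_absorb1)
    define R where "R n = norm (F u\<^sub>d - F (l n))" for n
    have res: "(\<lambda>k. norm (y (s k) - F (x (s k) n))) \<longlonglongrightarrow> R n" for n
      unfolding R_def by (intro tendsto_intros yss Fl)
    \<comment> \<open>The limit sequence inherits what the noisy iteration satisfies before it stops.\<close>
    have dec: "(norm (l (Suc n) - u\<^sub>d))\<^sup>2 + c * (R n)\<^sup>2 \<le> (norm (l n - u\<^sub>d))\<^sup>2" for n
    proof (rule tendsto_le[OF sequentially_bot])
      show "(\<lambda>k. (norm (x (s k) n - u\<^sub>d))\<^sup>2) \<longlonglongrightarrow> (norm (l n - u\<^sub>d))\<^sup>2"
        by (intro tendsto_intros l)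
      show "(\<lambda>k. (norm (x (s k) (Suc n) - u\<^sub>d))\<^sup>2 + c * (norm (y (s k) - F (x (s k) n)))\<^sup>2)
          \<longlonglongrightarrow> (norm (l (Suc n) - u\<^sub>d))\<^sup>2 + c * (R n)\<^sup>2"
        by (intro tendsto_intros l res)
      show "\<forall>\<^sub>F k in sequentially. (norm (x (s k) (Suc n) - u\<^sub>d))\<^sup>2
          + c * (norm (y (s k) - F (x (s k) n)))\<^sup>2 \<le> (norm (x (s k) n - u\<^sub>d))\<^sup>2"
        using late[of n]
      proof eventually_elim
        case (elim k)
        then show ?case
          using iter_decrease[OF \<delta> noise, of n "s k" u\<^sub>d] \<rho>
          by (simp add: x_eq N_def del: landweber.simps)
      qed
    qed
    have cross: "\<bar>(l (Suc i) - l i) \<bullet> (l n - u\<^sub>d)\<bar> \<le> (\<Lambda> * (1 + \<mu>)) * R i * (2 * R i + R n)" for i n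
    proof (rule tendsto_le[OF sequentially_bot])
      show "(\<lambda>k. \<bar>(x (s k) (Suc i) - x (s k) i) \<bullet> (x (s k) n - u\<^sub>d)\<bar>)
          \<longlonglongrightarrow> \<bar>(l (Suc i) - l i) \<bullet> (l n - u\<^sub>d)\<bar>"
        by (intro tendsto_intros l)
      have "(\<lambda>k. norm (F (x (s k) m) - F u\<^sub>d)) \<longlonglongrightarrow> R m" for m
        unfolding R_def by (subst norm_minus_commute) (intro tendsto_intros Fl)
      then show "(\<lambda>k. (\<Lambda> * (1 + \<mu>)) * norm (y (s k) - F (x (s k) i)) *
          (2 * norm (F (x (s k) i) - F u\<^sub>d) + norm (F (x (s k) n) - F u\<^sub>d)))
          \<longlonglongrightarrow> (\<Lambda> * (1 + \<mu>)) * R i * (2 * R i + R n)"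
        by (intro tendsto_intros res)
      show "\<forall>\<^sub>F k in sequentially. \<bar>(x (s k) (Suc i) - x (s k) i) \<bullet> (x (s k) n - u\<^sub>d)\<bar>
          \<le> (\<Lambda> * (1 + \<mu>)) * norm (y (s k) - F (x (s k) i)) *
          (2 * norm (F (x (s k) i) - F u\<^sub>d) + norm (F (x (s k) n) - F u\<^sub>d))"
        using late[of i] late[of n]
      proof eventually_elim
        case (elim k)
        then show ?case
          using increment_cross_bound[OF \<delta> noise, of i "s k" n]
          by (simp add: x_eq N_def del: landweber.simps)
      qed
    qed
    have "Cauchy (\<lambda>n. l n - u\<^sub>d)" and R0: "R \<longlonglongrightarrow> 0"
      using fejer_increments_Cauchy[of c "\<Lambda> * (1 + \<mu>)" R "\<lambda>n. l n - u\<^sub>d"] c_pos \<Lambda>0 \<mu> dec cross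
      by (auto simp: R_def)
    then obtain e where "(\<lambda>n. l n - u\<^sub>d) \<longlonglongrightarrow> e" using Cauchy_convergent_iff convergent_def by blast
    from tendsto_add[OF this tendsto_const[of u\<^sub>d]]
    obtain p where p: "l \<longlonglongrightarrow> p" by auto
    have pball: "p \<in> cball u\<^sub>d \<rho>"
      by (rule closed_sequentially[OF closed_cball _ p]) (rule lball)
    have "R \<longlonglongrightarrow> norm (F u\<^sub>d - F p)"
      unfolding R_def by (intro tendsto_intros completely_continuous_tendsto[OF cc p])
    with R0 have "norm (F u\<^sub>d - F p) = 0" using LIMSEQ_unique by blast
    then have Fp: "F p = F u\<^sub>d" by simp
    \<comment> \<open>As \<open>p\<close> is a solution, the stopped iterate is no farther from \<open>p\<close> than any earlier one.\<close>
    have "(\<lambda>k. v (s k)) \<longlonglongrightarrow> p"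
    proof (rule tendstoI)
      fix \<epsilon> :: real assume \<epsilon>: "0 < \<epsilon>"
      obtain n where n: "dist (l n) p < \<epsilon>"
        using tendstoD[OF p \<epsilon>] by (auto simp: eventually_sequentially)
      have "(\<lambda>k. dist (x (s k) n) p) \<longlonglongrightarrow> dist (l n) p" by (intro tendsto_intros l)
      from order_tendstoD(2)[OF this n] late[of n]
      show "\<forall>\<^sub>F k in sequentially. dist (v (s k)) p < \<epsilon>"
      proof eventually_elim
        case (elim k)
        then show ?case
          using iter_fejer[OF \<delta> noise _ pball Fp, of n "s k"]
          by (simp add: x_eq N_def v_def dist_norm)
      qed
    qed
    then show ?thesis using s pball Fp unfolding v_def N_def solution_set_def by blast
  qed
qed

end

lemma tendsto_of_subsubsequences:
  fixes v :: "nat \<Rightarrow> 'a::metric_space"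
  assumes "\<And>r::nat \<Rightarrow> nat. strict_mono r \<Longrightarrow> \<exists>s::nat \<Rightarrow> nat. strict_mono s \<and> (\<lambda>k. v (r (s k))) \<longlonglongrightarrow> l"
  shows "v \<longlonglongrightarrow> l"
proof (rule tendstoI, rule ccontr)
  fix e :: real assume e: "0 < e" and "\<not> (\<forall>\<^sub>F k in sequentially. dist (v k) l < e)"
  then have "infinite {k. \<not> dist (v k) l < e}"
    by (simp add: eventually_cofinite flip: cofinite_eq_sequentially)
  then obtain r :: "nat \<Rightarrow> nat" where r: "strict_mono r" and far: "\<And>k. \<not> dist (v (r k)) l < e"
    using infinite_enumerate by blast
  obtain s :: "nat \<Rightarrow> nat" where "(\<lambda>k. v (r (s k))) \<longlonglongrightarrow> l" using assms[OF r] by blast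
  from tendstoD[OF this e] show False using far by (auto simp: eventually_sequentially)
qed

section \<open>Convergence of the regularised solutions\<close>

theorem theorem2p10:
  fixes F :: "'u::{real_inner,banach} \<Rightarrow> 'y::{real_inner,banach}"
    and G :: "'u \<Rightarrow> 'u \<Rightarrow>\<^sub>L 'y"
    and j :: "'z::banach \<Rightarrow> 'u"
    and u\<^sub>d u\<^sub>0 :: 'u
    and L Lh \<rho>\<^sub>0 \<rho> \<mu> \<tau> lam \<Lambda> :: real
    and w \<delta> :: "nat \<Rightarrow> real"
    and y :: "nat \<Rightarrow> 'y"
  assumes "completely_continuous F"
    and "L > 0" and "\<rho>\<^sub>0 > 0"
    and "\<forall>u\<in>cball u\<^sub>d \<rho>\<^sub>0. norm (G u) \<le> L"
    and "0 < \<rho>" and "\<rho> \<le> \<rho>\<^sub>0" and "0 \<le> \<mu>" and "\<mu> < 1"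
    and "\<forall>u\<in>cball u\<^sub>d \<rho>. \<forall>u'\<in>cball u\<^sub>d \<rho>.
           norm (F u' - F u - blinfun_apply (G u) (u' - u)) \<le> \<mu> * norm (F u' - F u)"
    and "compact_embedding j"
    and "(\<Union>u. range (adjoint (blinfun_apply (G u)))) \<subseteq> range j"
    and "Lh > 0"
    and "\<forall>u\<in>cball u\<^sub>d \<rho>.
           bounded_linear (\<lambda>x. inv j (adjoint (blinfun_apply (G u)) x)) \<and>
           onorm (\<lambda>x. inv j (adjoint (blinfun_apply (G u)) x)) \<le> Lh"
    and "\<tau> > 1" and "0 < lam" and "lam \<le> \<Lambda>"
    and "2 * (\<mu> + 1) / \<tau> - (2 - 2 * \<mu> - \<Lambda> * L\<^sup>2) < 0"
    and "- 1 + \<mu> + 5 * \<Lambda> * L\<^sup>2 < 0"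
    and "\<forall>k. \<delta> k > 0" and "\<delta> \<longlonglongrightarrow> 0"
    and "\<forall>k. norm (y k - F u\<^sub>d) \<le> \<delta> k"
    and "u\<^sub>0 \<in> cball u\<^sub>d \<rho>"
    and "\<forall>n. w n \<in> {lam..\<Lambda>}"
  shows "let v = (\<lambda>k. landweber F G w u\<^sub>0 (y k) (stopping_index F G w u\<^sub>0 \<tau> (\<delta> k) (y k))) in
         (\<forall>r::nat \<Rightarrow> nat. strict_mono r \<longrightarrow>
            (\<exists>s::nat \<Rightarrow> nat. strict_mono s \<and>
              (\<exists>ub\<in>solution_set F u\<^sub>d \<rho>. (\<lambda>k. v (r (s k))) \<longlonglongrightarrow> ub)))
       \<and> ((\<forall>u. F u = F u\<^sub>d \<longrightarrow> u = u\<^sub>d) \<longrightarrow> v \<longlonglongrightarrow> u\<^sub>d)"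
proof -
  interpret landweber_cone F G u\<^sub>d u\<^sub>0 w L \<rho> \<mu> \<tau> lam \<Lambda>
  proof
    show "norm (G u) \<le> L" if "u \<in> cball u\<^sub>d \<rho>" for u
      using that assms(4,6) by auto
    show "norm (F u' - F u - G u (u' - u)) \<le> \<mu> * norm (F u' - F u)"
      if "u \<in> cball u\<^sub>d \<rho>" "u' \<in> cball u\<^sub>d \<rho>" for u u'
      using that assms(9) by blast
  qed (use assms in auto)
  define v where "v = (\<lambda>k. iter (y k) (stop (\<delta> k) (y k)))"
  have sub: "\<exists>s::nat \<Rightarrow> nat. strict_mono s \<and>
      (\<exists>ub\<in>solution_set F u\<^sub>d \<rho>. (\<lambda>k. v (r (s k))) \<longlonglongrightarrow> ub)"
    if r: "strict_mono r" for r :: "nat \<Rightarrow> nat"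
    unfolding v_def
  proof (rule exists_strongly_convergent_subsequence[where j = j and Lh = Lh
        and \<delta> = "\<lambda>k. \<delta> (r k)" and y = "\<lambda>k. y (r k)"])
    show "(\<lambda>k. \<delta> (r k)) \<longlonglongrightarrow> 0"
      using LIMSEQ_subseq_LIMSEQ[OF \<open>\<delta> \<longlonglongrightarrow> 0\<close> r] by (simp add: o_def)
    show "range (adjoint (G u)) \<subseteq> range j" for u
      using assms(11) by blast
  qed (use assms in auto)
  have "v \<longlonglongrightarrow> u\<^sub>d" if uniq: "\<forall>u. F u = F u\<^sub>d \<longrightarrow> u = u\<^sub>d"
  proof (rule tendsto_of_subsubsequences)
    fix r :: "nat \<Rightarrow> nat" assume "strict_mono r"
    then show "\<exists>s::nat \<Rightarrow> nat. strict_mono s \<and> (\<lambda>k. v (r (s k))) \<longlonglongrightarrow> u\<^sub>d"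
      using sub[of r] uniq by (auto simp: solution_set_def)
  qed
  with sub have "(\<forall>r::nat \<Rightarrow> nat. strict_mono r \<longrightarrow> (\<exists>s::nat \<Rightarrow> nat. strict_mono s \<and>
        (\<exists>ub\<in>solution_set F u\<^sub>d \<rho>. (\<lambda>k. v (r (s k))) \<longlonglongrightarrow> ub)))
      \<and> ((\<forall>u. F u = F u\<^sub>d \<longrightarrow> u = u\<^sub>d) \<longrightarrow> v \<longlonglongrightarrow> u\<^sub>d)"
    by (intro conjI allI impI)
  then show ?thesis unfolding Let_def v_def .
qed

end
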